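(* Let $k$ be a fixed positive integer. For every finite simple connected graph $G$ whose closed neighbourhood matrix $N[G]$ is a perfect matrix, $L_{\{k\}}(G)=k\,L_1(G)$; moreover, $L_{\{k\}}(G)$ can be found in polynomial time (in the size of the input graph $G$) on the class of graphs $G$ for which $N[G]$ is perfect.
   Context: For a graph $G=(V,E)$ and $v\in V$, $N(v)=\{u\in V: uv\in E\}$ and $N[v]=N(v)\cup\{v\}$. The closed neighbourhood matrix $N[G]=(a_{ij})$ is the $0,1$-matrix with rows and columns indexed by $V$ such that $a_{ij}=1$ if $i=j$ or $ij\in E$, and $a_{ij}=0$ otherwise. A $0,1$-matrix $M$ with $m$ rows and $n$ (nonzero) columns is perfect if the polyhedron $P(M)=\{x\in[0,1]^n: Mx\le \mathbf{1}\}$ is integer, i.e. all its extreme points are $0,1$-vectors, where $\mathbf 1$ is the all-ones vector of appropriate size. For a positive integer $k$, a $\{k\}$-packing function of $G$ is a function $f:V\to\mathbb{Z}_+$ (nonnegative integers) such that $f(N[v])=\sum_{w\in N[v]} f(w)\le k$ for every $v\in V$; $L_{\{k\}}(G)$ is the maximum of $f(V)=\sum_{v\in V}f(v)$ over all $\{k\}$-packing functions $f$ of $G$. A $k$-limited packing in $G$ is a function $f:V\to\{0,1\}$ with $f(N[v])\le k$ for every $v\in V$, and $L_k(G)$ is the maximum of $f(V)$ over all $k$-limited packings; in particular $L_1(G)=L_{\{1\}}(G)$. *)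

theory Defs
  imports
    "HOL-Analysis.Analysis"
    "HOL-Analysis.Finite_Function_Topology"
    "HOL-Computational_Algebra.Polynomial"
    "Graph_Theory.Graph_Theory"
begin

section \<open>Closed neighbourhoods and packing functions\<close>

text \<open>
  Finite simple graphs are the \<open>pair_graph\<close>s of the AFP entry \<open>Graph_Theory\<close>: finite vertex set
  \<open>pverts G\<close>, and a symmetric irreflexive relation \<open>parcs G\<close>, an edge $uv$ being the two
  arcs $(u,v)$ and $(v,u)$.
\<close>

definition open_nbhd :: "'a pair_pre_digraph \<Rightarrow> 'a \<Rightarrow> 'a set" where
  "open_nbhd G v = {u \<in> pverts G. (u, v) \<in> parcs G}"

definition closed_nbhd :: "'a pair_pre_digraph \<Rightarrow> 'a \<Rightarrow> 'a set" where
  "closed_nbhd G v = open_nbhd G v \<union> {v}"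

definition closed_nbhd_matrix :: "'a pair_pre_digraph \<Rightarrow> 'a \<Rightarrow> 'a \<Rightarrow> real" where
  "closed_nbhd_matrix G i j = (if i = j \<or> (i, j) \<in> parcs G then 1 else 0)"

text \<open>
  Functions on the vertex set are total functions here; their values outside \<open>pverts G\<close> are
  irrelevant for all notions below.
\<close>

definition brace_packing_function :: "nat \<Rightarrow> 'a pair_pre_digraph \<Rightarrow> ('a \<Rightarrow> nat) \<Rightarrow> bool" where
  "brace_packing_function k G f \<longleftrightarrow> (\<forall>v\<in>pverts G. (\<Sum>w\<in>closed_nbhd G v. f w) \<le> k)"

definition limited_packing :: "nat \<Rightarrow> 'a pair_pre_digraph \<Rightarrow> ('a \<Rightarrow> nat) \<Rightarrow> bool" where
  "limited_packing k G f \<longleftrightarrow>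
     (\<forall>v\<in>pverts G. f v \<in> {0, 1}) \<and> (\<forall>v\<in>pverts G. (\<Sum>w\<in>closed_nbhd G v. f w) \<le> k)"

text \<open>$L_{\{k\}}(G)$ and $L_k(G)$.\<close>

definition L_brace :: "nat \<Rightarrow> 'a pair_pre_digraph \<Rightarrow> nat" where
  "L_brace k G = Max {(\<Sum>v\<in>pverts G. f v) | f. brace_packing_function k G f}"

definition L_lim :: "nat \<Rightarrow> 'a pair_pre_digraph \<Rightarrow> nat" where
  "L_lim k G = Max {(\<Sum>v\<in>pverts G. f v) | f. limited_packing k G f}"


section \<open>Perfect matrices\<close>

text \<open>
  A matrix is indexed by finite sets \<open>R\<close> of rows and \<open>C\<close> of columns. The space
  $\mathbb{R}^C$ is the set of finitely supported functions with support in \<open>C\<close>, a subspace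
  of the real vector space \<open>'c \<Rightarrow>\<^sub>0 real\<close>, so that \<open>extreme_point_of\<close> is available.
\<close>

definition packing_polyhedron ::
    "'r set \<Rightarrow> 'c set \<Rightarrow> ('r \<Rightarrow> 'c \<Rightarrow> real) \<Rightarrow> ('c \<Rightarrow>\<^sub>0 real) set" where
  "packing_polyhedron R C M =
     {x. Poly_Mapping.keys x \<subseteq> C \<and>
         (\<forall>j\<in>C. 0 \<le> Poly_Mapping.lookup x j \<and> Poly_Mapping.lookup x j \<le> 1) \<and>
         (\<forall>i\<in>R. (\<Sum>j\<in>C. M i j * Poly_Mapping.lookup x j) \<le> 1)}"

definition perfect_matrix :: "'r set \<Rightarrow> 'c set \<Rightarrow> ('r \<Rightarrow> 'c \<Rightarrow> real) \<Rightarrow> bool" where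
  "perfect_matrix R C M \<longleftrightarrow>
     finite R \<and> finite C \<and>
     (\<forall>i\<in>R. \<forall>j\<in>C. M i j \<in> {0, 1}) \<and>
     (\<forall>j\<in>C. \<exists>i\<in>R. M i j \<noteq> 0) \<and>
     (\<forall>x. x extreme_point_of packing_polyhedron R C M \<longrightarrow>
        (\<forall>j\<in>C. Poly_Mapping.lookup x j \<in> {0, 1}))"


section \<open>Polynomial time\<close>

text \<open>
  The machine model is a random access machine with structured control, natural-number
  registers, a separate indirectly addressed memory, and unit cost for every instruction and
  test. The only arithmetic is addition and truncated subtraction. Hence the largest number
  stored is at most doubled in each step, or replaced by a constant of the program, numbers occurring
  in \<open>t\<close> steps have \<open>O(t)\<close> bits more than the input, and polynomial time in this unit-cost
  model is polynomial time on Turing machines. (With unit-cost multiplication this would fail.)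
\<close>

datatype com =
    Skip
  | Const nat nat       \<comment> \<open>\<open>Const r c\<close>: \<open>reg r := c\<close>\<close>
  | Add nat nat nat     \<comment> \<open>\<open>Add r a b\<close>: \<open>reg r := reg a + reg b\<close>\<close>
  | Sub nat nat nat     \<comment> \<open>\<open>Sub r a b\<close>: \<open>reg r := reg a - reg b\<close>, truncated at 0\<close>
  | Load nat nat        \<comment> \<open>\<open>Load r a\<close>: \<open>reg r := mem (reg a)\<close>\<close>
  | Store nat nat       \<comment> \<open>\<open>Store a r\<close>: \<open>mem (reg a) := reg r\<close>\<close>
  | Seq com com
  | Cond nat com com    \<comment> \<open>branches on \<open>reg r \<noteq> 0\<close>\<close>
  | While nat com       \<comment> \<open>loops while \<open>reg r \<noteq> 0\<close>\<close>

type_synonym state = "(nat \<Rightarrow> nat) \<times> (nat \<Rightarrow> nat)" \<comment> \<open>registers and memory\<close>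

text \<open>\<open>exec c s t s'\<close>: started in \<open>s\<close>, the program \<open>c\<close> halts in \<open>s'\<close> after \<open>t\<close> steps.\<close>

inductive exec :: "com \<Rightarrow> state \<Rightarrow> nat \<Rightarrow> state \<Rightarrow> bool" where
  exec_Skip: "exec Skip s 1 s"
| exec_Const: "exec (Const r c) (g, m) 1 (g(r := c), m)"
| exec_Add: "exec (Add r a b) (g, m) 1 (g(r := g a + g b), m)"
| exec_Sub: "exec (Sub r a b) (g, m) 1 (g(r := g a - g b), m)"
| exec_Load: "exec (Load r a) (g, m) 1 (g(r := m (g a)), m)"
| exec_Store: "exec (Store a r) (g, m) 1 (g, m(g a := g r))"
| exec_Seq: "exec c1 s t1 s' \<Longrightarrow> exec c2 s' t2 s'' \<Longrightarrow> exec (Seq c1 c2) s (t1 + t2) s''"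
| exec_Cond_True: "fst s r \<noteq> 0 \<Longrightarrow> exec c1 s t s' \<Longrightarrow> exec (Cond r c1 c2) s (Suc t) s'"
| exec_Cond_False: "fst s r = 0 \<Longrightarrow> exec c2 s t s' \<Longrightarrow> exec (Cond r c1 c2) s (Suc t) s'"
| exec_While_False: "fst s r = 0 \<Longrightarrow> exec (While r c) s 1 s"
| exec_While_True: "fst s r \<noteq> 0 \<Longrightarrow> exec c s t1 s' \<Longrightarrow> exec (While r c) s' t2 s'' \<Longrightarrow>
    exec (While r c) s (Suc (t1 + t2)) s''"

inductive_cases exec_SkipE: "exec Skip s t s'"
inductive_cases exec_ConstE: "exec (Const r c) s t s'"
inductive_cases exec_AddE: "exec (Add r a b) s t s'"
inductive_cases exec_SubE: "exec (Sub r a b) s t s'"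
inductive_cases exec_LoadE: "exec (Load r a) s t s'"
inductive_cases exec_StoreE: "exec (Store a r) s t s'"
inductive_cases exec_SeqE: "exec (Seq c1 c2) s t s'"
inductive_cases exec_CondE: "exec (Cond r c1 c2) s t s'"
inductive_cases exec_WhileE: "exec (While r c) s t s'"

lemma exec_deterministic:
  "exec c s t s' \<Longrightarrow> exec c s u s'' \<Longrightarrow> u = t \<and> s'' = s'"
proof (induction arbitrary: u s'' rule: exec.induct)
  case exec_Seq
  show ?case
    by (rule exec_SeqE[OF exec_Seq.prems]) (drule exec_Seq.IH(1), simp, drule exec_Seq.IH(2), simp)
next
  case exec_Cond_True
  show ?case
    by (rule exec_CondE[OF exec_Cond_True.prems]) (use exec_Cond_True.hyps in \<open>auto dest!: exec_Cond_True.IH\<close>)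
next
  case exec_Cond_False
  show ?case
    by (rule exec_CondE[OF exec_Cond_False.prems]) (use exec_Cond_False.hyps in \<open>auto dest!: exec_Cond_False.IH\<close>)
next
  case exec_While_False
  show ?case
    by (rule exec_WhileE[OF exec_While_False.prems]) (use exec_While_False.hyps in auto)
next
  case (exec_While_True s r c t1 s' t2 s2)
  show ?case
  proof (rule exec_WhileE[OF exec_While_True.prems])
    assume "fst s r = 0"
    with exec_While_True.hyps show ?thesis by simp
  qed (drule exec_While_True.IH(1), simp, drule exec_While_True.IH(2), simp)
qed (erule exec_SkipE exec_ConstE exec_AddE exec_SubE exec_LoadE exec_StoreE, simp)+

text \<open>
  A graph with vertices listed as \<open>vs\<close>, $n$ in number, is presented by $n$ in register 0 and its
  adjacency matrix, row by row, in memory cells $0, \dots, n^2 - 1$; everything else is 0.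
\<close>

definition graph_input :: "'a pair_pre_digraph \<Rightarrow> 'a list \<Rightarrow> state" where
  "graph_input G vs =
     (let n = length vs in
       ((\<lambda>_. 0)(0 := n),
        (\<lambda>a. if a < n * n \<and> (vs ! (a div n), vs ! (a mod n)) \<in> parcs G then 1 else 0)))"

text \<open>
  One program computes \<open>F G\<close> (left in register 0) for all graphs \<open>G\<close> in the class \<open>\<G>\<close>, whatever
  the order in which the vertices are listed, in time polynomial in the number of vertices.
  On graphs outside \<open>\<G>\<close> nothing is required.
\<close>

definition poly_time_computable_on ::
    "'a pair_pre_digraph set \<Rightarrow> ('a pair_pre_digraph \<Rightarrow> nat) \<Rightarrow> bool" where
  "poly_time_computable_on \<G> F \<longleftrightarrow>
     (\<exists>c. \<exists>p :: nat poly. \<forall>G\<in>\<G>. \<forall>vs. distinct vs \<and> set vs = pverts G \<longrightarrow>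
        (\<exists>t g m. exec c (graph_input G vs) t (g, m) \<and> g 0 = F G \<and> t \<le> poly p (length vs)))"

end

theory Submission
  imports Defs
begin

text \<open>
  Let \<open>\<tau>\<close> be $L_1(G)$. If $f$ is a $\{k\}$-packing function then $f/k$ lies in the polytope
  $P = \{x \in [0,1]^V : N[G]\,x \le \mathbf 1\}$. A linear objective on a polytope is dominated at an
  extreme point, and for a perfect $N[G]$ that point is a 0,1-vector, that is, a 1-limited packing.
  Hence $f(V) \le k\tau$ (\<open>perfect_brace_packing_bound\<close>), and $k$ times an optimal 1-limited
  packing attains this value.
  
  For the algorithm, \<open>\<tau>\<close> has to be computed in polynomial time. The bound just given, read for all
  $k$ at once, says that \<open>\<tau>\<close> is the optimum of the linear program
  $\max \{\mathbf 1 x : N[G]\,x \le \mathbf 1, x \ge 0\}$. As the optimum is an integer, an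
  approximation with error less than one determines it, and such an approximation is
  within reach of a simple iterative method that handles only small natural numbers.
  
  Fix $s \in \{1, \dots, n\}$. The method builds a multiset of $t$ vertices with multiplicities $c_j$, and
  watches the excess $d_i = \max(0, s\,(N c)_i - t)$ of the vector $x = (s/t)\,c$, whose coordinates sum
  to $s$, over the constraints $N x \le \mathbf 1$, scaled by $t$. A vertex $j$ may be added
  if $s \sum_{i \in N[j]} d_i \le \sum_i d_i$; then the inner product of $d$ with the change of
  $s N c - t$ is not positive, so $\sum_i d_i^2$ grows by at most $n s^2$ per addition
  (\<open>regret_step\<close>). This is Blackwell's approachability argument for the orthant.
    \<^item> If $s \le \tau$, some vertex can always be added: summed over an optimal packing, whose
      vertices meet each closed neighbourhood at most once, the sums $\sum_{i \in N[j]} d_i$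
      add up to at most $\sum_i d_i$ (\<open>some_column_accepted\<close>).
    \<^item> If $s > \tau$, then fewer than $n^5$ vertices are ever added: $d_i \le s \sqrt{nt}$ makes $x$
      feasible after scaling by $1 / (1 + s\sqrt{n/t})$, so for $t \ge n^5$ the optimum exceeds $s - 1$
      (\<open>many_updates_imp_le_value\<close>).
  
  So $n^5$ passes over the vertices decide whether $s \le \tau$, and adding $k$ to the output for
  each $s \in \{1, \dots, n\}$ that passes the test yields $k\tau$. Addition and truncated
  subtraction suffice for all of this. The program is verified with a calculus of weakest
  preconditions in which the postcondition also sees the running time.
\<close>

section \<open>Linear programs over perfect matrices\<close>

text \<open>
  The polytope is given by finitely many inequalities inside a subspace \<open>W\<close>, and the
  hypothesis \<open>bdd\<close> says that it contains no ray, so that no topology is required. A point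
  that is not extreme can be moved along a segment through it, in the direction in which the objective
  does not decrease, until one more inequality becomes tight; inequalities that are tight already stay
  tight. The number of slack inequalities therefore decreases.
\<close>

lemma extreme_point_dominates:
  fixes F :: "(('v::real_vector \<Rightarrow> real) \<times> real) set" and g :: "'v \<Rightarrow> real"
  assumes W: "subspace W" and fin: "finite F"
    and lin: "\<And>l b. (l, b) \<in> F \<Longrightarrow> linear l" and "linear g"
    and bdd: "\<And>d. d \<in> W \<Longrightarrow> d \<noteq> 0 \<Longrightarrow> \<exists>(l, b)\<in>F. l d > 0"
    and P: "P = {x \<in> W. \<forall>(l, b)\<in>F. l x \<le> b}" and "x \<in> P"
  shows "\<exists>y. y extreme_point_of P \<and> g x \<le> g y"
  using \<open>x \<in> P\<close>
proof (induction "card {(l, b)\<in>F. l x < b}" arbitrary: x rule: less_induct)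
  case less
  show ?case
  proof (cases "x extreme_point_of P")
    case True
    then show ?thesis by blast
  next
    case False
    then obtain p q where pq: "p \<in> P" "q \<in> P" "x \<in> open_segment p q"
      using less.prems by (auto simp: extreme_point_of_def)
    then obtain u where u: "0 < u" "u < 1" "x = (1 - u) *\<^sub>R p + u *\<^sub>R q" and "p \<noteq> q"
      by (auto simp: in_segment)
    define d where "d = (if g (q - p) \<ge> 0 then q - p else p - q)"
    have dW: "d \<in> W" and "d \<noteq> 0" and gd: "g d \<ge> 0"
      using pq(1,2) \<open>p \<noteq> q\<close> W linear_diff[OF \<open>linear g\<close>] unfolding P d_def
      by (auto intro: subspace_diff)
    \<comment> \<open>An inequality tight at an inner point of a segment in \<open>P\<close> is tight along the whole segment.\<close>
    have tight: "l d = 0" if "(l, b) \<in> F" "l x = b" for l b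
    proof -
      have le: "l p \<le> b" "l q \<le> b" using pq that P by auto
      have eq: "b = (1 - u) * l p + u * l q"
        using that(2) u(3) lin[OF that(1)] by (simp add: linear_add linear_scale)
      have "(1 - u) * (b - l p) + u * (b - l q) = 0"
        using eq by (simp add: algebra_simps)
      moreover have "(1 - u) * (b - l p) \<ge> 0" "u * (b - l q) \<ge> 0" using le u by auto
      ultimately have "(1 - u) * (b - l p) = 0" "u * (b - l q) = 0" by linarith+
      then have "l p = b" "l q = b" using u by auto
      then show ?thesis using linear_diff[OF lin[OF that(1)]] by (simp add: d_def)
    qed
    define K where "K = {(l, b)\<in>F. l d > 0}"
    define ratio where "ratio = (\<lambda>(l :: 'v \<Rightarrow> real, b). (b - l x) / l d)"
    \<comment> \<open>\<open>\<mu>\<close> is the largest step along \<open>d\<close> that stays in \<open>P\<close>.\<close>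
    define \<mu> where "\<mu> = Min (ratio ` K)"
    have "K \<subseteq> F" by (auto simp: K_def)
    then have K: "finite K" "K \<noteq> {}"
      using fin bdd[OF dW \<open>d \<noteq> 0\<close>] finite_subset by (auto simp: K_def)
    have x: "x \<in> W" "\<And>l b. (l, b) \<in> F \<Longrightarrow> l x \<le> b" using less.prems P by auto
    have \<mu>_le: "\<mu> \<le> (b - l x) / l d" if "(l, b) \<in> K" for l b
      using K that by (force simp: \<mu>_def ratio_def intro!: Min_le)
    obtain l0 b0 where l0: "(l0, b0) \<in> K" "\<mu> = (b0 - l0 x) / l0 d"
      using Min_in[of "ratio ` K"] K unfolding \<mu>_def[symmetric] by (auto simp: ratio_def)
    have "l0 x < b0" using l0 x tight[of l0 b0] by (force simp: K_def)
    then have "\<mu> > 0" using l0 by (simp add: K_def)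
    define y where "y = x + \<mu> *\<^sub>R d"
    have ly: "l y = l x + \<mu> * l d" if "(l, b) \<in> F" for l b
      using lin[OF that] by (simp add: y_def linear_add linear_scale)
    have "l y \<le> b" if lb: "(l, b) \<in> F" for l b
    proof (cases "l d > 0")
      case True
      then show ?thesis using \<mu>_le[of l b] ly[OF lb] lb by (simp add: K_def field_simps)
    next
      case False
      then have "\<mu> * l d \<le> 0" using \<open>\<mu> > 0\<close> by (simp add: mult_le_0_iff)
      then show ?thesis using ly[OF lb] x(2)[OF lb] by simp
    qed
    then have "y \<in> P" using x(1) dW W by (auto simp: P y_def intro: subspace_add subspace_scale)
    have "l0 y = b0" using l0 ly[of l0 b0] by (auto simp: K_def field_simps)
    have "{(l, b)\<in>F. l y < b} \<subset> {(l, b)\<in>F. l x < b}"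
    proof
      have "l x \<noteq> b" if "(l, b) \<in> F" "l y < b" for l b
        using that ly[of l b] tight[of l b] by auto
      then show "{(l, b)\<in>F. l y < b} \<subseteq> {(l, b)\<in>F. l x < b}"
        using x(2) by (auto simp: order_less_le)
      have "(l0, b0) \<in> {(l, b)\<in>F. l x < b}" "(l0, b0) \<notin> {(l, b)\<in>F. l y < b}"
        using l0 \<open>l0 x < b0\<close> \<open>l0 y = b0\<close> by (auto simp: K_def)
      then show "{(l, b)\<in>F. l y < b} \<noteq> {(l, b)\<in>F. l x < b}" by blast
    qed
    then have "card {(l, b)\<in>F. l y < b} < card {(l, b)\<in>F. l x < b}"
      by (intro psubset_card_mono) (auto intro: finite_subset[OF _ fin])
    from less.hyps[OF this \<open>y \<in> P\<close>] obtain z where "z extreme_point_of P" "g y \<le> g z" by blast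
    moreover have "g x \<le> g y"
      using gd \<open>\<mu> > 0\<close> \<open>linear g\<close> by (simp add: y_def linear_add linear_scale)
    ultimately show ?thesis by (meson order_trans)
  qed
qed

lemma lookup_scaleR:
  fixes v :: "'c \<Rightarrow>\<^sub>0 real"
  shows "Poly_Mapping.lookup (r *\<^sub>R v) j = r * Poly_Mapping.lookup v j"
proof -
  have "finite {i. r * Poly_Mapping.lookup v i \<noteq> 0}"
    by (rule finite_subset[OF _ finite_lookup[of v]]) auto
  then show ?thesis by (simp add: scaleR_poly_mapping_def lookup_Abs_poly_mapping)
qed

text \<open>
  Perfection used in the form of linear programming: a fractional packing is dominated by an
  integral one.
\<close>

lemma perfect_matrix_dominating_01_vector:
  fixes M :: "'r \<Rightarrow> 'c \<Rightarrow> real"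
  assumes perf: "perfect_matrix R C M"
    and x: "\<And>j. j \<in> C \<Longrightarrow> 0 \<le> x j \<and> x j \<le> 1" "\<And>i. i \<in> R \<Longrightarrow> (\<Sum>j\<in>C. M i j * x j) \<le> 1"
  shows "\<exists>y :: 'c \<Rightarrow> nat. (\<forall>j\<in>C. y j \<in> {0, 1}) \<and> (\<forall>i\<in>R. (\<Sum>j\<in>C. M i j * real (y j)) \<le> 1) \<and>
    (\<Sum>j\<in>C. x j) \<le> real (\<Sum>j\<in>C. y j)"
proof -
  have fin: "finite R" "finite C" using perf by (auto simp: perfect_matrix_def)
  define W where "W = {v :: 'c \<Rightarrow>\<^sub>0 real. Poly_Mapping.keys v \<subseteq> C}"
  define F :: "((('c \<Rightarrow>\<^sub>0 real) \<Rightarrow> real) \<times> real) set" where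
    "F = (\<lambda>j. (\<lambda>v. - Poly_Mapping.lookup v j, 0)) ` C \<union> (\<lambda>j. (\<lambda>v. Poly_Mapping.lookup v j, 1)) ` C
       \<union> (\<lambda>i. (\<lambda>v. \<Sum>j\<in>C. M i j * Poly_Mapping.lookup v j, 1)) ` R"
  define g where "g = (\<lambda>v :: 'c \<Rightarrow>\<^sub>0 real. \<Sum>j\<in>C. Poly_Mapping.lookup v j)"
  have P: "packing_polyhedron R C M = {v \<in> W. \<forall>(l, b)\<in>F. l v \<le> b}"
    unfolding packing_polyhedron_def W_def F_def ball_Un by auto
  define v :: "'c \<Rightarrow>\<^sub>0 real" where "v = Poly_Mapping.Abs_poly_mapping (\<lambda>j. if j \<in> C then x j else 0)"
  have v: "Poly_Mapping.lookup v = (\<lambda>j. if j \<in> C then x j else 0)"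
    unfolding v_def by (rule Abs_poly_mapping_inverse) (use fin in \<open>auto intro: finite_subset[of _ C]\<close>)
  have "W = {v. \<forall>j. j \<notin> C \<longrightarrow> Poly_Mapping.lookup v j = 0}"
    unfolding W_def by (auto simp: in_keys_iff)
  then have W: "subspace W" by (simp add: subspace_def lookup_add lookup_scaleR)
  have "\<exists>y. y extreme_point_of packing_polyhedron R C M \<and> g v \<le> g y"
  proof (rule extreme_point_dominates[OF W _ _ _ _ P])
    show "finite F" using fin by (simp add: F_def)
    show "linear l" if "(l, b) \<in> F" for l b
      using that
      by (auto simp: F_def lookup_add lookup_scaleR sum.distrib sum_distrib_left algebra_simps
          intro!: linearI)
    show "linear g"
      by (auto simp: g_def lookup_add lookup_scaleR sum.distrib sum_distrib_left intro!: linearI)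
    show "\<exists>(l, b)\<in>F. 0 < l d" if "d \<in> W" "d \<noteq> 0" for d
    proof -
      obtain j where j: "Poly_Mapping.lookup d j \<noteq> 0"
        using \<open>d \<noteq> 0\<close> by (metis poly_mapping_eqI lookup_zero)
      then have "j \<in> C" using \<open>d \<in> W\<close> by (auto simp: W_def in_keys_iff)
      then have F: "(\<lambda>v. - Poly_Mapping.lookup v j, 0) \<in> F" "(\<lambda>v. Poly_Mapping.lookup v j, 1) \<in> F"
        by (auto simp: F_def)
      show ?thesis
      proof (cases "Poly_Mapping.lookup d j > 0")
        case True
        then show ?thesis by (intro bexI[OF _ F(2)]) simp
      next
        case False
        then show ?thesis using j by (intro bexI[OF _ F(1)]) simp
      qed
    qed
    show "v \<in> packing_polyhedron R C M"
      using x by (auto simp: packing_polyhedron_def v in_keys_iff subset_iff split: if_splits)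
  qed
  then obtain y where y: "y extreme_point_of packing_polyhedron R C M" "g v \<le> g y" by blast
  have y01: "Poly_Mapping.lookup y j \<in> {0, 1}" if "j \<in> C" for j
    using perf y(1) that unfolding perfect_matrix_def by blast
  have yP: "y \<in> packing_polyhedron R C M" using y(1) by (simp add: extreme_point_of_def)
  define z where "z = (\<lambda>j. nat \<lfloor>Poly_Mapping.lookup y j\<rfloor>)"
  have z: "real (z j) = Poly_Mapping.lookup y j" "z j \<in> {0, 1}" if "j \<in> C" for j
    using y01[OF that] by (auto simp: z_def)
  have "(\<Sum>j\<in>C. M i j * real (z j)) \<le> 1" if "i \<in> R" for i
    using yP that by (simp add: packing_polyhedron_def z)
  moreover have "(\<Sum>j\<in>C. x j) \<le> real (\<Sum>j\<in>C. z j)"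
    using y(2) by (simp add: g_def v z)
  ultimately show ?thesis using z(2) by blast
qed

section \<open>Packing functions of graphs with perfect closed neighbourhood matrix\<close>

text \<open>
  Sums over closed neighbourhoods become sums over a fixed index set, the form in which both the
  polytope and the program treat them.
\<close>

lemma sum_closed_nbhd:
  fixes f :: "'a \<Rightarrow> 'b::semiring_1"
  assumes "pair_graph G" "v \<in> pverts G"
  shows "(\<Sum>w\<in>closed_nbhd G v. f w) = (\<Sum>w\<in>pverts G. of_bool (v = w \<or> (v, w) \<in> parcs G) * f w)"
proof -
  interpret pair_graph G by fact
  have "closed_nbhd G v = pverts G \<inter> closed_nbhd G v"
    using assms(2) by (auto simp: closed_nbhd_def open_nbhd_def)
  then have "(\<Sum>w\<in>closed_nbhd G v. f w) = (\<Sum>w\<in>pverts G. if w \<in> closed_nbhd G v then f w else 0)"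
    by (metis sum.inter_restrict pair_finite_verts)
  also have "\<dots> = (\<Sum>w\<in>pverts G. of_bool (v = w \<or> (v, w) \<in> parcs G) * f w)"
    using arcs_symmetric assms(2)
    by (intro sum.cong) (auto simp: closed_nbhd_def open_nbhd_def)
  finally show ?thesis .
qed

lemma closed_nbhd_matrix_sum:
  assumes "pair_graph G" "v \<in> pverts G"
  shows "(\<Sum>w\<in>pverts G. closed_nbhd_matrix G v w * f w) = (\<Sum>w\<in>closed_nbhd G v. f w)"
  unfolding sum_closed_nbhd[OF assms] by (simp add: closed_nbhd_matrix_def of_bool_def)

lemma brace_packing_function_le:
  assumes "pair_graph G" "brace_packing_function k G f" "v \<in> pverts G"
  shows "f v \<le> k"
proof -
  interpret pair_graph G by fact
  have "finite (closed_nbhd G v)" by (simp add: closed_nbhd_def open_nbhd_def)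
  moreover have "v \<in> closed_nbhd G v" by (simp add: closed_nbhd_def)
  ultimately have "f v \<le> (\<Sum>w\<in>closed_nbhd G v. f w)" by (intro member_le_sum) auto
  then show ?thesis using assms by (force simp: brace_packing_function_def)
qed

lemma finite_packing_values:
  assumes "pair_graph G"
  shows "finite {(\<Sum>v\<in>pverts G. f v) | f. brace_packing_function k G f}"
proof -
  have "(\<Sum>v\<in>pverts G. f v) \<le> card (pverts G) * k" if "brace_packing_function k G f" for f
    using sum_bounded_above[of "pverts G" f k] brace_packing_function_le[OF assms that] by simp
  then have "{(\<Sum>v\<in>pverts G. f v) | f. brace_packing_function k G f} \<subseteq> {..card (pverts G) * k}"
    by auto
  then show ?thesis by (rule finite_subset) simp
qed

lemma limited_imp_brace: "limited_packing k G f \<Longrightarrow> brace_packing_function k G f"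
  by (simp add: limited_packing_def brace_packing_function_def)

lemma L_lim_attained:
  assumes "pair_graph G"
  obtains f where "limited_packing k G f" "(\<Sum>v\<in>pverts G. f v) = L_lim k G"
    "\<And>h. limited_packing k G h \<Longrightarrow> (\<Sum>v\<in>pverts G. h v) \<le> L_lim k G"
proof -
  let ?S = "{(\<Sum>v\<in>pverts G. f v) | f. limited_packing k G f}"
  have "?S \<subseteq> {(\<Sum>v\<in>pverts G. f v) | f. brace_packing_function k G f}"
    using limited_imp_brace by blast
  then have fin: "finite ?S" using finite_packing_values[OF assms] by (rule finite_subset)
  have "limited_packing k G (\<lambda>_. 0)" by (simp add: limited_packing_def)
  then have "?S \<noteq> {}" by blast
  from Max_in[OF fin this] obtain f where f: "limited_packing k G f" "Max ?S = (\<Sum>v\<in>pverts G. f v)"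
    by auto
  show ?thesis
  proof
    show "limited_packing k G f" by fact
    show "(\<Sum>v\<in>pverts G. f v) = L_lim k G" using f(2) by (simp add: L_lim_def)
    fix h assume h: "limited_packing k G h"
    show "(\<Sum>v\<in>pverts G. h v) \<le> L_lim k G"
      unfolding L_lim_def by (rule Max_ge[OF fin]) (use h in blast)
  qed
qed

text \<open>
  The vector $f/k$ satisfies the constraints of the polytope; the bound on single coordinates holds
  since $v \in N[v]$.
\<close>

lemma perfect_brace_packing_bound:
  assumes G: "pair_graph G" and perf: "perfect_matrix (pverts G) (pverts G) (closed_nbhd_matrix G)"
    and f: "brace_packing_function k G f"
  shows "(\<Sum>v\<in>pverts G. f v) \<le> k * L_lim 1 G"
proof (cases "k = 0")
  case True
  then show ?thesis using brace_packing_function_le[OF G f] by simp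
next
  case False
  let ?x = "\<lambda>v. real (f v) / real k"
  have "0 \<le> ?x v \<and> ?x v \<le> 1" if "v \<in> pverts G" for v
    using brace_packing_function_le[OF G f that] False by simp
  moreover have "(\<Sum>w\<in>pverts G. closed_nbhd_matrix G v w * ?x w) \<le> 1" if "v \<in> pverts G" for v
  proof -
    have "real (\<Sum>w\<in>closed_nbhd G v. f w) \<le> real k"
      using f that unfolding brace_packing_function_def of_nat_le_iff by blast
    then show ?thesis
      unfolding closed_nbhd_matrix_sum[OF G that] sum_divide_distrib[symmetric]
      using False by (simp add: of_nat_sum)
  qed
  ultimately obtain y where y01: "\<forall>v\<in>pverts G. y v \<in> {0, 1}"
    and y: "\<forall>v\<in>pverts G. (\<Sum>w\<in>pverts G. closed_nbhd_matrix G v w * real (y w)) \<le> 1"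
    and le: "(\<Sum>v\<in>pverts G. ?x v) \<le> real (\<Sum>v\<in>pverts G. y v)"
    using perfect_matrix_dominating_01_vector[OF perf, of ?x] by blast
  have "(\<Sum>w\<in>closed_nbhd G v. y w) \<le> 1" if "v \<in> pverts G" for v
    using bspec[OF y that] unfolding closed_nbhd_matrix_sum[OF G that]
    by (simp flip: of_nat_sum)
  then have "limited_packing 1 G y" using y01 by (simp add: limited_packing_def)
  then have "(\<Sum>v\<in>pverts G. y v) \<le> L_lim 1 G" using L_lim_attained[OF G] by metis
  then have "(\<Sum>v\<in>pverts G. ?x v) \<le> real (L_lim 1 G)" using le by linarith
  then have "real (\<Sum>v\<in>pverts G. f v) \<le> real (k * L_lim 1 G)"
    using False by (simp add: sum_divide_distrib[symmetric] field_simps)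
  then show ?thesis by linarith
qed

text \<open>
  The upper bound is attained by $k$ times an optimal 1-limited packing.
\<close>

lemma perfect_L_brace:
  assumes G: "pair_graph G" and perf: "perfect_matrix (pverts G) (pverts G) (closed_nbhd_matrix G)"
  shows "L_brace k G = k * L_lim 1 G"
  unfolding L_brace_def
proof (rule Max_eqI)
  show "finite {(\<Sum>v\<in>pverts G. f v) | f. brace_packing_function k G f}"
    by (rule finite_packing_values[OF G])
  show "y \<le> k * L_lim 1 G" if "y \<in> {(\<Sum>v\<in>pverts G. f v) | f. brace_packing_function k G f}" for y
    using that perfect_brace_packing_bound[OF G perf] by auto
  obtain f where f: "limited_packing 1 G f" "(\<Sum>v\<in>pverts G. f v) = L_lim 1 G"
    using L_lim_attained[OF G] by metis
  have "(\<Sum>w\<in>closed_nbhd G v. k * f w) \<le> k * 1" if "v \<in> pverts G" for v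
    unfolding sum_distrib_left[symmetric]
    using f(1) that unfolding limited_packing_def by (intro mult_left_mono) auto
  then have "brace_packing_function k G (\<lambda>v. k * f v)"
    by (simp add: brace_packing_function_def)
  moreover have "(\<Sum>v\<in>pverts G. k * f v) = k * L_lim 1 G"
    using f(2) by (simp add: sum_distrib_left[symmetric])
  ultimately show "k * L_lim 1 G \<in> {(\<Sum>v\<in>pverts G. f v) | f. brace_packing_function k G f}"
    by (metis (mono_tags, lifting) mem_Collect_eq)
qed

section \<open>Approximate solution of the packing program by small integers\<close>

text \<open>
  The potential inequality behind the algorithm. With $r_i = P_i - t$ and the increment
  $\delta_i = s a_i - 1$, truncation at zero only helps, $\max(0, r_i + \delta_i)^2 \le (d_i + \delta_i)^2$
  for $d_i = \max(0, r_i)$; the cross term $\sum_i d_i \delta_i$ is not positive by \<open>accept\<close>,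
  and $\delta_i^2 \le s^2$.
\<close>

lemma regret_step:
  fixes a P :: "nat \<Rightarrow> nat"
  assumes "s \<ge> 1" and a: "\<And>i. i < n \<Longrightarrow> a i \<le> 1"
    and accept: "s * (\<Sum>i<n. a i * (P i - t)) \<le> (\<Sum>i<n. P i - t)"
    and bound: "(\<Sum>i<n. (P i - t)\<^sup>2) \<le> t * (n * s\<^sup>2)"
  shows "(\<Sum>i<n. (P i + s * a i - Suc t)\<^sup>2) \<le> Suc t * (n * s\<^sup>2)"
proof -
  define d where "d i = int (P i - t)" for i
  have step: "int ((P i + s * a i - Suc t)\<^sup>2) \<le> (d i)\<^sup>2 + 2 * (int s * (int (a i) * d i) - d i) + (int s)\<^sup>2"
    if "i < n" for i
  proof -
    define \<delta> where "\<delta> = int s * int (a i) - 1"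
    have a01: "a i = 0 \<or> a i = 1" using a[OF that] by linarith
    have "int (P i + s * a i - Suc t) \<le> \<bar>d i + \<delta>\<bar>"
      using a01 \<open>s \<ge> 1\<close> by (auto simp: d_def \<delta>_def)
    then have "(int (P i + s * a i - Suc t))\<^sup>2 \<le> (d i + \<delta>)\<^sup>2"
      by (metis abs_le_square_iff abs_of_nat)
    moreover have "\<bar>\<delta>\<bar> \<le> \<bar>int s\<bar>" using a01 \<open>s \<ge> 1\<close> by (auto simp: \<delta>_def)
    then have "\<delta>\<^sup>2 \<le> (int s)\<^sup>2" by (simp only: abs_le_square_iff)
    moreover have "(d i + \<delta>)\<^sup>2 = (d i)\<^sup>2 + 2 * (int s * (int (a i) * d i) - d i) + \<delta>\<^sup>2"
      by (simp add: \<delta>_def power2_eq_square algebra_simps)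
    ultimately show ?thesis by simp
  qed
  have "int (\<Sum>i<n. (P i + s * a i - Suc t)\<^sup>2)
      \<le> (\<Sum>i<n. (d i)\<^sup>2 + 2 * (int s * (int (a i) * d i) - d i) + (int s)\<^sup>2)"
    unfolding of_nat_sum by (intro sum_mono step) simp
  also have "\<dots> = (\<Sum>i<n. (d i)\<^sup>2) + 2 * (int s * (\<Sum>i<n. int (a i) * d i) - (\<Sum>i<n. d i))
      + int n * (int s)\<^sup>2"
    by (simp add: sum.distrib sum_subtractf sum_distrib_left)
  also have "(\<Sum>i<n. (d i)\<^sup>2) = int (\<Sum>i<n. (P i - t)\<^sup>2)"
    by (simp add: d_def)
  also have "int s * (\<Sum>i<n. int (a i) * d i) = int (s * (\<Sum>i<n. a i * (P i - t)))"
    by (simp add: d_def)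
  also have "(\<Sum>i<n. d i) = int (\<Sum>i<n. P i - t)"
    by (simp add: d_def)
  also have "int n * (int s)\<^sup>2 = int (n * s\<^sup>2)" by simp
  finally have "int (\<Sum>i<n. (P i + s * a i - Suc t)\<^sup>2)
    \<le> int (\<Sum>i<n. (P i - t)\<^sup>2) + 2 * (int (s * (\<Sum>i<n. a i * (P i - t))) - int (\<Sum>i<n. P i - t))
      + int (n * s\<^sup>2)" .
  moreover have "X \<le> Y + Z" if "int X \<le> int Y + 2 * (int A - int B) + int Z" "A \<le> B"
    for X Y Z A B :: nat
  proof -
    have "int X \<le> int (Y + Z)" using that by simp
    then show ?thesis by (simp only: of_nat_le_iff)
  qed
  ultimately have "(\<Sum>i<n. (P i + s * a i - Suc t)\<^sup>2) \<le> (\<Sum>i<n. (P i - t)\<^sup>2) + n * s\<^sup>2"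
    using accept by blast
  with bound show ?thesis by simp
qed

text \<open>
  What the algorithm requires of the closed neighbourhood matrix, as a matrix game with value
  $1/\tau$: \<open>packing_bound\<close> says that no fractional packing has total weight above \<open>\<tau>\<close> (with
  denominators cleared), and \<open>cheap_column\<close> says that against any nonnegative weights \<open>d\<close> on the rows
  some column has weight at most a \<open>1/\<tau>\<close> fraction of the total.
\<close>

locale covering_game =
  fixes a :: "nat \<Rightarrow> nat \<Rightarrow> nat" and n \<tau> :: nat
  assumes entry_le_1: "i < n \<Longrightarrow> j < n \<Longrightarrow> a i j \<le> 1"
    and entry_sym: "i < n \<Longrightarrow> j < n \<Longrightarrow> a i j = a j i"
    and packing_bound: "(\<And>i. i < n \<Longrightarrow> (\<Sum>j<n. a i j * c j) \<le> M) \<Longrightarrow> (\<Sum>j<n. c j) \<le> M * \<tau>"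
    and cheap_column: "1 \<le> \<tau> \<Longrightarrow> \<exists>j<n. \<tau> * (\<Sum>i<n. a j i * d i) \<le> (\<Sum>i<n. d i)"
    and value_le: "\<tau> \<le> n"
begin

definition accepts :: "nat \<Rightarrow> (nat \<Rightarrow> nat) \<Rightarrow> nat \<Rightarrow> nat \<Rightarrow> bool" where
  "accepts s P t j \<longleftrightarrow> s * (\<Sum>i<n. a j i * (P i - t)) \<le> (\<Sum>i<n. P i - t)"

text \<open>
  The invariant of the algorithm: \<open>P\<close> comes from a multiset of \<open>t\<close> columns, and the
  squared excesses obey the bound that \<open>regret_step\<close> maintains.
\<close>

definition reachable :: "nat \<Rightarrow> (nat \<Rightarrow> nat) \<Rightarrow> nat \<Rightarrow> bool" where
  "reachable s P t \<longleftrightarrow> (\<exists>c. (\<Sum>j<n. c j) = t \<and> (\<forall>i<n. P i = s * (\<Sum>j<n. a i j * c j)))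
     \<and> (\<Sum>i<n. (P i - t)\<^sup>2) \<le> t * (n * s\<^sup>2)"

lemma reachable_initial: "(\<And>i. i < n \<Longrightarrow> P i = 0) \<Longrightarrow> reachable s P 0"
  unfolding reachable_def by (auto intro!: exI[of _ "\<lambda>_. 0"])

lemma reachable_update:
  assumes "reachable s P t" "1 \<le> s" "j < n" "accepts s P t j"
    and P': "\<And>i. i < n \<Longrightarrow> P' i = P i + s * a j i"
  shows "reachable s P' (Suc t)"
proof -
  obtain c where c: "(\<Sum>j<n. c j) = t" "\<And>i. i < n \<Longrightarrow> P i = s * (\<Sum>j<n. a i j * c j)"
    and bound: "(\<Sum>i<n. (P i - t)\<^sup>2) \<le> t * (n * s\<^sup>2)"
    using assms(1) unfolding reachable_def by blast
  let ?c = "\<lambda>l. c l + (if l = j then 1 else 0)"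
  have "(\<Sum>l<n. ?c l) = Suc t" using c(1) \<open>j < n\<close> by (simp add: sum.distrib)
  moreover have "P' i = s * (\<Sum>l<n. a i l * ?c l)" if "i < n" for i
  proof -
    have "(\<Sum>l<n. a i l * ?c l) = (\<Sum>l<n. a i l * c l) + (\<Sum>l<n. if l = j then a i l else 0)"
      unfolding sum.distrib[symmetric] by (intro sum.cong) auto
    also have "(\<Sum>l<n. if l = j then a i l else 0) = a i j" using \<open>j < n\<close> by simp
    finally show ?thesis
      using P'[OF that] c(2)[OF that] entry_sym[OF that \<open>j < n\<close>] by (simp add: algebra_simps)
  qed
  moreover have "(\<Sum>i<n. (P' i - Suc t)\<^sup>2) = (\<Sum>i<n. (P i + s * a j i - Suc t)\<^sup>2)"
    using P' by (intro sum.cong) auto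
  then have "(\<Sum>i<n. (P' i - Suc t)\<^sup>2) \<le> Suc t * (n * s\<^sup>2)"
    using regret_step[OF \<open>1 \<le> s\<close> _ _ bound, of "a j"] assms(3,4) entry_le_1
    by (simp add: accepts_def)
  ultimately show ?thesis unfolding reachable_def by blast
qed

lemma some_column_accepted:
  assumes "1 \<le> s" "s \<le> \<tau>"
  shows "\<exists>j<n. accepts s P t j"
proof -
  obtain j where "j < n" "\<tau> * (\<Sum>i<n. a j i * (P i - t)) \<le> (\<Sum>i<n. P i - t)"
    using cheap_column[of "\<lambda>i. P i - t"] assms by auto
  moreover have "s * (\<Sum>i<n. a j i * (P i - t)) \<le> \<tau> * (\<Sum>i<n. a j i * (P i - t))"
    using assms by (intro mult_right_mono) auto
  ultimately show ?thesis unfolding accepts_def by (meson order_trans)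
qed

text \<open>
  Let $M$ be the largest entry of $N c$, in row $i$. If \<open>\<tau> < s\<close>, then $t \le M \tau \le M (s-1)$, which
  forces an excess $d_i = s M - t$ with $t \le (s-1)\,d_i$. As $d_i^2 \le t n s^2$, this gives
  $t \le (s-1)^2 n s^2 < n^5$.
\<close>

lemma many_updates_imp_le_value:
  assumes "reachable s P t" "1 \<le> s" "s \<le> n" "n ^ 5 \<le> t"
  shows "s \<le> \<tau>"
proof (rule ccontr)
  assume "\<not> s \<le> \<tau>"
  then have \<tau>: "\<tau> \<le> s - 1" by simp
  obtain c where c: "(\<Sum>j<n. c j) = t" "\<And>i. i < n \<Longrightarrow> P i = s * (\<Sum>j<n. a i j * c j)"
    and bound: "(\<Sum>i<n. (P i - t)\<^sup>2) \<le> t * (n * s\<^sup>2)"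
    using assms(1) unfolding reachable_def by blast
  define M where "M = Max ((\<lambda>i. \<Sum>j<n. a i j * c j) ` {..<n})"
  have "n > 0" using assms by simp
  then have "M \<in> (\<lambda>i. \<Sum>j<n. a i j * c j) ` {..<n}"
    unfolding M_def by (intro Max_in) auto
  then obtain i where i: "i < n" "M = (\<Sum>j<n. a i j * c j)" by auto
  have "(\<Sum>j<n. a i j * c j) \<le> M" if "i < n" for i
    unfolding M_def using that by (intro Max_ge) auto
  then have "t \<le> M * \<tau>" using packing_bound[of c M] c(1) by simp
  also have "\<dots> \<le> M * (s - 1)" using \<tau> by simp
  finally have tM: "t \<le> M * (s - 1)" .
  have "t > 0" using \<open>n > 0\<close> assms(4) by (metis gr0I le_zero_eq zero_less_power less_numeral_extra(3))
  define d where "d = P i - t"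
  have "d\<^sup>2 \<le> (\<Sum>i<n. (P i - t)\<^sup>2)"
    unfolding d_def using i(1) by (intro member_le_sum) auto
  then have d2: "d\<^sup>2 \<le> t * (n * s\<^sup>2)" using bound by linarith
  have Pi: "P i = s * M" using c(2) i by simp
  have "s * t \<le> s * (M * (s - 1))" using tM by simp
  also have "\<dots> = (s - 1) * (s * M)" by simp
  also have "\<dots> \<le> (s - 1) * (d + t)" unfolding d_def Pi by (intro mult_left_mono) auto
  finally have "t \<le> (s - 1) * d"
    using \<open>1 \<le> s\<close> by (cases s) (auto simp: algebra_simps)
  then have "t * t \<le> ((s - 1) * d) * ((s - 1) * d)" by (intro mult_mono) auto
  also have "\<dots> = (s - 1)\<^sup>2 * d\<^sup>2" by (simp add: power2_eq_square)
  also have "\<dots> \<le> (s - 1)\<^sup>2 * (t * (n * s\<^sup>2))" using d2 by simp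
  also have "\<dots> = t * ((s - 1)\<^sup>2 * (n * s\<^sup>2))" by simp
  finally have "t \<le> (s - 1)\<^sup>2 * (n * s\<^sup>2)" using \<open>t > 0\<close> by simp
  also have "\<dots> \<le> (s - 1)\<^sup>2 * (n * n\<^sup>2)" using assms(3) by (intro mult_left_mono power_mono) auto
  also have "\<dots> < n\<^sup>2 * (n * n\<^sup>2)"
    using assms(2,3) \<open>n > 0\<close> by (intro mult_strict_right_mono power_strict_mono) auto
  also have "\<dots> = n ^ 5" by (simp add: eval_nat_numeral)
  finally show False using assms(4) by simp
qed

end

section \<open>Weakest preconditions with running time\<close>

text \<open>
  Weakest preconditions with running time: the postcondition receives the number of steps,
  the registers and the memory at termination. For loop-free programs the equations below compute
  \<open>wp\<close>, so that their verification is simplification.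
\<close>

definition wp :: "com \<Rightarrow> (nat \<Rightarrow> (nat \<Rightarrow> nat) \<Rightarrow> (nat \<Rightarrow> nat) \<Rightarrow> bool) \<Rightarrow> (nat \<Rightarrow> nat) \<Rightarrow> (nat \<Rightarrow> nat) \<Rightarrow> bool"
  where "wp c Q g m \<longleftrightarrow> (\<exists>t g' m'. exec c (g, m) t (g', m') \<and> Q t g' m')"

lemma wp_basic [simp]:
  "wp Skip Q g m \<longleftrightarrow> Q 1 g m"
  "wp (Const r v) Q g m \<longleftrightarrow> Q 1 (g(r := v)) m"
  "wp (Add r x y) Q g m \<longleftrightarrow> Q 1 (g(r := g x + g y)) m"
  "wp (Sub r x y) Q g m \<longleftrightarrow> Q 1 (g(r := g x - g y)) m"
  "wp (Load r x) Q g m \<longleftrightarrow> Q 1 (g(r := m (g x))) m"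
  "wp (Store x r) Q g m \<longleftrightarrow> Q 1 g (m(g x := g r))"
  unfolding wp_def
  by (auto intro: exec.intros[unfolded One_nat_def]
      elim: exec_SkipE exec_ConstE exec_AddE exec_SubE exec_LoadE exec_StoreE)

lemma wp_Seq [simp]:
  "wp (Seq c1 c2) Q g m \<longleftrightarrow> wp c1 (\<lambda>t1. wp c2 (\<lambda>t2. Q (t1 + t2))) g m"
proof
  assume "wp (Seq c1 c2) Q g m"
  then obtain t g' m' where ex: "exec (Seq c1 c2) (g, m) t (g', m')" and "Q t g' m'"
    unfolding wp_def by blast
  from ex show "wp c1 (\<lambda>t1. wp c2 (\<lambda>t2. Q (t1 + t2))) g m"
  proof (rule exec_SeqE)
    fix t1 s' t2
    assume "t = t1 + t2" "exec c1 (g, m) t1 s'" "exec c2 s' t2 (g', m')"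
    with \<open>Q t g' m'\<close> show ?thesis unfolding wp_def by (cases s') blast
  qed
next
  assume "wp c1 (\<lambda>t1. wp c2 (\<lambda>t2. Q (t1 + t2))) g m"
  then show "wp (Seq c1 c2) Q g m" unfolding wp_def using exec_Seq by blast
qed

lemma wp_Cond [simp]:
  "wp (Cond r c1 c2) Q g m \<longleftrightarrow> wp (if g r \<noteq> 0 then c1 else c2) (\<lambda>t. Q (Suc t)) g m"
proof
  assume "wp (Cond r c1 c2) Q g m"
  then obtain t g' m' where ex: "exec (Cond r c1 c2) (g, m) t (g', m')" and "Q t g' m'"
    unfolding wp_def by blast
  from ex show "wp (if g r \<noteq> 0 then c1 else c2) (\<lambda>t. Q (Suc t)) g m"
    by (rule exec_CondE) (use \<open>Q t g' m'\<close> in \<open>auto simp: wp_def\<close>)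
next
  assume "wp (if g r \<noteq> 0 then c1 else c2) (\<lambda>t. Q (Suc t)) g m"
  then obtain t g' m' where "exec (if g r \<noteq> 0 then c1 else c2) (g, m) t (g', m')" "Q (Suc t) g' m'"
    unfolding wp_def by blast
  moreover from this have "exec (Cond r c1 c2) (g, m) (Suc t) (g', m')"
    by (cases "g r = 0") (auto intro: exec_Cond_True exec_Cond_False)
  ultimately show "wp (Cond r c1 c2) Q g m" unfolding wp_def by blast
qed

lemma wp_mono:
  assumes "wp c R g m" "\<And>t g' m'. R t g' m' \<Longrightarrow> Q t g' m'"
  shows "wp c Q g m"
  using assms unfolding wp_def by blast

fun block :: "com list \<Rightarrow> com" where
  "block [] = Skip"
| "block (c # cs) = Seq c (block cs)"

text \<open>
  The registers. \<open>rN\<close> holds the number $n$ of vertices on input, \<open>rOne\<close> the constant 1, \<open>rNN\<close>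
  the number $n^2$, \<open>rQ\<close> the number $n^5$ of passes, \<open>rK\<close> the factor $k$, \<open>rOut\<close> the output collected so
  far, \<open>rS\<close> the current guess $s$ and \<open>rT\<close> the number $t$ of columns added. \<open>rPass\<close>, \<open>rJ\<close>, \<open>rI\<close> and
  \<open>rCnt\<close> are loop counters, \<open>rA\<close> and \<open>rB\<close> the two sums that decide about a column, and the others are
  scratch.
\<close>

abbreviation (input) rN :: nat where "rN \<equiv> 0"
abbreviation (input) rOne :: nat where "rOne \<equiv> 2"
abbreviation (input) rNN :: nat where "rNN \<equiv> 3"
abbreviation (input) rQ :: nat where "rQ \<equiv> 4"
abbreviation (input) rK :: nat where "rK \<equiv> 5"
abbreviation (input) rOut :: nat where "rOut \<equiv> 6"
abbreviation (input) rS :: nat where "rS \<equiv> 7"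
abbreviation (input) rT :: nat where "rT \<equiv> 8"
abbreviation (input) rPass :: nat where "rPass \<equiv> 9"
abbreviation (input) rJ :: nat where "rJ \<equiv> 10"
abbreviation (input) rI :: nat where "rI \<equiv> 11"
abbreviation (input) rA :: nat where "rA \<equiv> 12"
abbreviation (input) rB :: nat where "rB \<equiv> 13"
abbreviation (input) rBase :: nat where "rBase \<equiv> 14"
abbreviation (input) rAddr :: nat where "rAddr \<equiv> 15"
abbreviation (input) rVal :: nat where "rVal \<equiv> 16"
abbreviation (input) rIdx :: nat where "rIdx \<equiv> 17"
abbreviation (input) rCnt :: nat where "rCnt \<equiv> 18"
abbreviation (input) rProd :: nat where "rProd \<equiv> 19"

text \<open>
  The counter runs downwards, because a loop of the machine ends when its register reaches 0. A body
  that works on index \<open>i\<close> runs while the counter is \<open>Suc i\<close>.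
\<close>

definition For :: "nat \<Rightarrow> com \<Rightarrow> com" where
  "For r body = While r (Seq body (Sub r r rOne))"

text \<open>
  The loop rule. In the invariant \<open>I i\<close>, the number \<open>i\<close> is the number of iterations still to come.
  The body has to preserve the counter and establish \<open>I i\<close> for the state in which the counter has
  already been decremented.
\<close>

lemma wp_For:
  assumes "I (g r) g m" "g rOne = 1" "r \<noteq> rOne"
    and step: "\<And>i h mm. i < g r \<Longrightarrow> I (Suc i) h mm \<Longrightarrow> h r = Suc i \<Longrightarrow> h rOne = 1 \<Longrightarrow>
      wp body (\<lambda>t h' mm'. t \<le> T \<and> h' r = Suc i \<and> h' rOne = 1 \<and> I i (h'(r := i)) mm') h mm"
  shows "wp (For r body) (\<lambda>t g' m'. t \<le> g r * (T + 2) + 1 \<and> I 0 g' m' \<and> g' r = 0 \<and> g' rOne = 1) g m"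
proof -
  have "wp (For r body) (\<lambda>t h' mm'. t \<le> i * (T + 2) + 1 \<and> I 0 h' mm' \<and> h' r = 0 \<and> h' rOne = 1) h mm"
    if "i \<le> g r" "I i h mm" "h r = i" "h rOne = 1" for i h mm
    using that
  proof (induction i arbitrary: h mm)
    case 0
    then show ?case unfolding wp_def For_def by (fastforce intro: exec_While_False)
  next
    case (Suc i)
    from step[of i h mm] Suc.prems obtain t1 h1 m1 where
      body: "exec body (h, mm) t1 (h1, m1)" "t1 \<le> T" "h1 r = Suc i" "h1 rOne = 1" "I i (h1(r := i)) m1"
      unfolding wp_def by auto
    have "wp (For r body) (\<lambda>t h' mm'. t \<le> i * (T + 2) + 1 \<and> I 0 h' mm' \<and> h' r = 0 \<and> h' rOne = 1)
        (h1(r := i)) m1"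
      by (rule Suc.IH[OF _ body(5)]) (use Suc.prems(1) body(4) \<open>r \<noteq> rOne\<close> in auto)
    then obtain t2 h2 m2 where
      rest: "exec (For r body) (h1(r := i), m1) t2 (h2, m2)" "t2 \<le> i * (T + 2) + 1"
        "I 0 h2 m2" "h2 r = 0" "h2 rOne = 1"
      unfolding wp_def by blast
    have "exec (Sub r r rOne) (h1, m1) 1 (h1(r := i), m1)"
      using exec_Sub[of r r rOne h1 m1] body by simp
    from exec_While_True[OF _ exec_Seq[OF body(1) this] rest(1)[unfolded For_def]]
    have "exec (For r body) (h, mm) (Suc (t1 + 1 + t2)) (h2, m2)"
      using Suc.prems(3) by (simp add: For_def)
    moreover have "Suc (t1 + 1 + t2) \<le> Suc i * (T + 2) + 1" using body(2) rest(2) by simp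
    ultimately show ?case unfolding wp_def using rest by blast
  qed
  then show ?thesis using assms by blast
qed

definition Copy :: "nat \<Rightarrow> nat \<Rightarrow> com" where
  "Copy r x = Seq (Const r 0) (Add r r x)"

lemma wp_Copy [simp]:
  "wp (Copy r x) Q g m \<longleftrightarrow> Q 2 (g(r := if x = r then 0 else g x)) m"
  by (simp add: Copy_def numeral_2_eq_2)

definition Mul :: "nat \<Rightarrow> nat \<Rightarrow> nat \<Rightarrow> com" where
  "Mul z x y = block [Const z 0, Copy rCnt x, For rCnt (Add z z y)]"

lemma wp_Mul:
  assumes "g rOne = 1" "z \<noteq> x" "z \<noteq> y" "z \<noteq> rCnt" "z \<noteq> rOne" "x \<noteq> rCnt" "y \<noteq> rCnt"
  shows "wp (Mul z x y) (\<lambda>t g' m'. t \<le> 3 * g x + 5 \<and> g' = g(z := g x * g y, rCnt := 0) \<and> m' = m) g m"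
proof -
  let ?g = "g(z := 0, rCnt := g x)"
  have step: "(g x - Suc i) * g y + g y = (g x - i) * g y" if "i < g x" for i
    using that by (metis Suc_diff_Suc add.commute mult_Suc)
  have "wp (For rCnt (Add z z y))
      (\<lambda>t g' m'. t \<le> ?g rCnt * (1 + 2) + 1 \<and>
        (g' = g(z := (g x - 0) * g y, rCnt := 0) \<and> m' = m) \<and> g' rCnt = 0 \<and> g' rOne = 1) ?g m"
    by (rule wp_For[where T = 1 and I = "\<lambda>i g' m'. g' = g(z := (g x - i) * g y, rCnt := i) \<and> m' = m"])
      (use assms step in \<open>auto simp: fun_eq_iff\<close>)
  then show ?thesis
    using assms by (auto simp: Mul_def elim!: wp_mono)
qed

section \<open>The program\<close>

text \<open>
  The program. Cell $i n + j$ of the memory holds the entry $a_{ij}$ of the closed neighbourhood matrix,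
  and cell $n^2 + i$ holds $P_i = s\,(N c)_i$. \<open>column\<close> adds the column $j$ if it
  is accepted, \<open>pass\<close> tries all columns once, and \<open>test\<close> adds \<open>k\<close> to the output if $s \le \tau$.
  The input is the adjacency matrix, whose diagonal \<open>set_diagonal\<close> sets to 1.
\<close>

definition row_sums :: com where
  "row_sums = block [Const rA 0, Const rB 0, Copy rI rN, For rI (block [
     Sub rIdx rI rOne,
     Add rAddr rNN rIdx, Load rVal rAddr, Sub rVal rVal rT, Add rB rB rVal,
     Add rAddr rBase rIdx, Load rAddr rAddr, Cond rAddr (Add rA rA rVal) Skip])]"

definition add_row :: com where
  "add_row = block [Copy rI rN, For rI (block [
     Sub rIdx rI rOne, Add rAddr rBase rIdx, Load rVal rAddr,
     Cond rVal (block [Add rAddr rNN rIdx, Load rVal rAddr, Add rVal rVal rS, Store rAddr rVal]) Skip])]"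

definition column :: com where
  "column = block [Sub rIdx rJ rOne, Mul rBase rIdx rN, row_sums, Mul rProd rS rA,
     Sub rProd rProd rB, Cond rProd Skip (block [add_row, Add rT rT rOne])]"

definition pass :: com where
  "pass = block [Copy rJ rN, For rJ column]"

definition reset :: com where
  "reset = block [Copy rI rN, Const rVal 0, For rI (block [
     Sub rIdx rI rOne, Add rAddr rNN rIdx, Store rAddr rVal])]"

definition test :: com where
  "test = block [reset, Const rT 0, Copy rPass rQ, For rPass pass,
     Sub rProd rQ rT, Cond rProd Skip (Add rOut rOut rK)]"

definition set_diagonal :: com where
  "set_diagonal = block [Copy rI rN, For rI (block [
     Sub rIdx rI rOne, Mul rAddr rIdx rN, Add rAddr rAddr rIdx, Store rAddr rOne])]"

definition main :: "nat \<Rightarrow> com" where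
  "main k = block [Const rOne 1, Const rK k, Mul rNN rN rN, Mul rProd rNN rNN, Mul rQ rN rProd,
     set_diagonal, Const rOut 0, Copy rS rN, For rS test, Copy rN rOut]"

section \<open>Correctness and running time of the program\<close>

lemma cell_div:
  fixes i j n :: nat
  assumes "j < n"
  shows "(i * n + j) div n = i"
  using assms by auto

lemma cell_inj:
  fixes i j i' j' n :: nat
  assumes "j < n" "j' < n"
  shows "i * n + j = i' * n + j' \<longleftrightarrow> i = i' \<and> j = j'"
  using assms by (metis cell_div add_left_cancel)

lemma cell_less:
  fixes i j n :: nat
  assumes "i < n" "j < n"
  shows "i * n + j < n * n"
proof -
  have "i * n + j < Suc i * n" using assms by simp
  also have "\<dots> \<le> n * n" using assms by (intro mult_right_mono) auto
  finally show ?thesis .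
qed

text \<open>
  Bounds on the number of steps that \<open>test\<close> and \<open>main\<close> take on an input with \<open>n\<close> vertices. As in the
  specifications of the smaller pieces, constants are rounded up: all that counts is that the bounds
  are polynomials.
\<close>

definition test_time :: "nat \<Rightarrow> nat" where
  "test_time n = n ^ 5 * (n * (30 * n + 42) + 6) + 7 * n + 20"

definition main_time :: "nat \<Rightarrow> nat" where
  "main_time n = 3 * n\<^sup>2 + n * (3 * n + 11)
     + n * (test_time n + 2) + 6 * n + 40"

context covering_game
begin

definition matrix :: "(nat \<Rightarrow> nat) \<Rightarrow> bool" where
  "matrix m \<longleftrightarrow> (\<forall>i<n. \<forall>j<n. m (i * n + j) = a i j)"

definition represents :: "(nat \<Rightarrow> nat) \<Rightarrow> (nat \<Rightarrow> nat) \<Rightarrow> bool" where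
  "represents m P \<longleftrightarrow> matrix m \<and> (\<forall>i<n. m (n * n + i) = P i)"

definition env :: "(nat \<Rightarrow> nat) \<Rightarrow> bool" where
  "env g \<longleftrightarrow> g rN = n \<and> g rOne = 1 \<and> g rNN = n * n"

lemma matrix_store: "matrix m \<Longrightarrow> matrix (m(n * n + i := v))"
  by (auto simp: matrix_def dest: cell_less)

lemma represents_store:
  "represents m P \<Longrightarrow> represents (m(n * n + i := v)) (P(i := v))"
  by (auto simp: represents_def matrix_store)

lemma represents_cong:
  "represents m P \<Longrightarrow> (\<And>i. i < n \<Longrightarrow> P i = P' i) \<Longrightarrow> represents m P'"
  by (auto simp: represents_def)

lemma wp_row_sums:
  assumes m: "represents m P" and g: "env g" "g rBase = j * n" "j < n"
  shows "wp row_sums (\<lambda>t g' m'. t \<le> 12 * n + 6 \<and> m' = m \<and>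
      (\<forall>r. r \<notin> {rI, rA, rB, rAddr, rVal, rIdx} \<longrightarrow> g' r = g r) \<and>
      g' rA = (\<Sum>i<n. a j i * (P i - g rT)) \<and> g' rB = (\<Sum>i<n. P i - g rT)) g m"
proof -
  let ?I = "\<lambda>i g' m'. m' = m \<and> (\<forall>r. r \<notin> {rI, rA, rB, rAddr, rVal, rIdx} \<longrightarrow> g' r = g r) \<and>
      g' rA = (\<Sum>l=i..<n. a j l * (P l - g rT)) \<and> g' rB = (\<Sum>l=i..<n. P l - g rT)"
  let ?g = "g(rA := 0, rB := 0, rI := n)"
  have "wp (For rI (block [
     Sub rIdx rI rOne,
     Add rAddr rNN rIdx, Load rVal rAddr, Sub rVal rVal rT, Add rB rB rVal,
     Add rAddr rBase rIdx, Load rAddr rAddr, Cond rAddr (Add rA rA rVal) Skip]))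
     (\<lambda>t g' m'. t \<le> ?g rI * (10 + 2) + 1 \<and> ?I 0 g' m' \<and> g' rI = 0 \<and> g' rOne = 1) ?g m"
  proof (rule wp_For, goal_cases)
    case (4 i h mm)
    have i: "i < n" using 4 by simp
    have cells: "m (n * n + i) = P i" "m (j * n + i) = a j i"
      using m i g(3) by (auto simp: represents_def matrix_def)
    have "a j i = 0 \<or> a j i = 1" using entry_le_1[OF g(3) i] by linarith
    then show ?case
      using 4 g i cells by (auto simp: env_def sum.atLeast_Suc_lessThan)
  qed (use g in \<open>auto simp: env_def\<close>)
  then show ?thesis
    using g by (auto simp: row_sums_def env_def atLeast0LessThan elim!: wp_mono)
qed

lemma wp_add_row:
  assumes m: "represents m P" and g: "env g" "g rBase = j * n" "j < n"
  shows "wp add_row (\<lambda>t g' m'. t \<le> 12 * n + 4 \<and> represents m' (\<lambda>i. P i + g rS * a j i) \<and>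
      (\<forall>r. r \<notin> {rI, rAddr, rVal, rIdx} \<longrightarrow> g' r = g r)) g m"
proof -
  let ?I = "\<lambda>i g' m'. represents m' (\<lambda>l. if i \<le> l then P l + g rS * a j l else P l) \<and>
      (\<forall>r. r \<notin> {rI, rAddr, rVal, rIdx} \<longrightarrow> g' r = g r)"
  let ?g = "g(rI := n)"
  have "wp (For rI (block [
     Sub rIdx rI rOne, Add rAddr rBase rIdx, Load rVal rAddr,
     Cond rVal (block [Add rAddr rNN rIdx, Load rVal rAddr, Add rVal rVal rS, Store rAddr rVal]) Skip]))
     (\<lambda>t g' m'. t \<le> ?g rI * (10 + 2) + 1 \<and> ?I 0 g' m' \<and> g' rI = 0 \<and> g' rOne = 1) ?g m"
  proof (rule wp_For, goal_cases)
    case 1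
    show ?case using m by (auto intro: represents_cong)
  next
    case (4 i h mm)
    have i: "i < n" using 4 by simp
    have cells: "mm (n * n + i) = P i" "mm (j * n + i) = a j i"
      using 4 i g(3) by (auto simp: represents_def matrix_def)
    have "a j i = 0 \<or> a j i = 1" using entry_le_1[OF g(3) i] by linarith
    then show ?case
    proof
      assume "a j i = 0"
      moreover from this have "represents mm (\<lambda>l. if i \<le> l then P l + g rS * a j l else P l)"
        using 4 by (auto intro: represents_cong simp: Suc_le_eq order_le_less)
      ultimately show ?thesis using 4 g i cells by (auto simp: env_def)
    next
      assume "a j i = 1"
      moreover from this have "represents (mm(n * n + i := P i + g rS))
          (\<lambda>l. if i \<le> l then P l + g rS * a j l else P l)"
        using 4 by (intro represents_cong[OF represents_store[of mm "\<lambda>l. if Suc i \<le> l then P l + g rS * a j l else P l"]])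
          auto
      ultimately show ?thesis using 4 g i cells by (auto simp: env_def)
    qed
  qed (use g in \<open>auto simp: env_def\<close>)
  then show ?thesis
    using g by (auto simp: add_row_def env_def elim!: wp_mono)
qed

lemma wp_column:
  assumes m: "represents m P" and g: "env g" "g rJ = Suc j" "j < n" and s: "g rS = s" "s \<le> n"
  shows "wp column (\<lambda>t g' m'. t \<le> 30 * n + 40 \<and>
      (\<forall>r. r \<notin> {rT, rI, rA, rB, rBase, rAddr, rVal, rIdx, rCnt, rProd} \<longrightarrow> g' r = g r) \<and>
      (if accepts s P (g rT) j
       then g' rT = Suc (g rT) \<and> represents m' (\<lambda>i. P i + s * a j i)
       else g' rT = g rT \<and> represents m' P)) g m"
  unfolding column_def block.simps wp_Seq wp_basic(4)
proof (rule wp_mono[OF wp_Mul], goal_cases)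
  case (8 t1 g1 m1)
  then have g1: "env g1" "g1 rBase = j * n" "t1 \<le> 3 * n + 5" "m1 = m" "g1 rT = g rT" "g1 rS = s"
      "\<forall>r. r \<notin> {rBase, rIdx, rCnt} \<longrightarrow> g1 r = g r"
    using g s by (auto simp: env_def)
  show ?case
  proof (rule wp_mono[OF wp_row_sums[of m1 P g1 j]], goal_cases)
    case (5 t2 g2 m2)
    then have g2: "env g2" "g2 rBase = j * n" "m2 = m" "g2 rT = g rT" "g2 rS = s"
      using g1 by (auto simp: env_def)
    show ?case
    proof (rule wp_mono[OF wp_Mul], goal_cases)
      case (8 t3 g3 m3)
      then have g3: "env g3" "g3 rBase = j * n" "m3 = m" "g3 rT = g rT" "g3 rS = s"
          "t3 \<le> 3 * n + 5"
          "g3 rProd = s * (\<Sum>i<n. a j i * (P i - g rT))" "g3 rB = (\<Sum>i<n. P i - g rT)"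
          "\<forall>r. r \<notin> {rI, rA, rB, rBase, rAddr, rVal, rIdx, rCnt, rProd} \<longrightarrow> g3 r = g r"
        using g2 s(2) 5 g1 by (auto simp: env_def)
      let ?g = "g3(rProd := g3 rProd - g3 rB)"
      show ?case
      proof (cases "accepts s P (g rT) j")
        case True
        then have "?g rProd = 0" using g3 by (simp add: accepts_def)
        moreover have "wp add_row (\<lambda>t g' m'. t \<le> 12 * n + 4 \<and> represents m' (\<lambda>i. P i + ?g rS * a j i) \<and>
            (\<forall>r. r \<notin> {rI, rAddr, rVal, rIdx} \<longrightarrow> g' r = ?g r)) ?g m3"
          using m g3 g by (intro wp_add_row) (auto simp: env_def)
        ultimately show ?thesis
          using True g1 g3 5(1) g by (auto simp: env_def elim!: wp_mono)
      next
        case False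
        then have "?g rProd \<noteq> 0" using g3 by (simp add: accepts_def)
        then show ?thesis using False g1 g3 5(1) g m by (auto simp: env_def)
      qed
    qed (use g2 in \<open>auto simp: env_def\<close>)
  qed (use m g g1 in auto)
qed (use g in \<open>auto simp: env_def\<close>)

text \<open>
  A pass makes progress when $s \le \tau$: if no column had been added, then all of them
  would have been rejected in one and the same state, against \<open>some_column_accepted\<close>.
\<close>

lemma wp_pass:
  assumes m: "represents m P" and g: "env g" and s: "g rS = s" "1 \<le> s" "s \<le> n"
    and reach: "reachable s P (g rT)"
  shows "wp pass (\<lambda>t g' m'. t \<le> n * (30 * n + 42) + 4 \<and>
      (\<forall>r. r \<notin> {rT, rJ, rI, rA, rB, rBase, rAddr, rVal, rIdx, rCnt, rProd} \<longrightarrow> g' r = g r) \<and>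
      (\<exists>P'. represents m' P' \<and> reachable s P' (g' rT)) \<and>
      (s \<le> \<tau> \<longrightarrow> g rT < g' rT)) g m"
proof -
  let ?I = "\<lambda>j g' m'.
      (\<forall>r. r \<notin> {rT, rJ, rI, rA, rB, rBase, rAddr, rVal, rIdx, rCnt, rProd} \<longrightarrow> g' r = g r) \<and>
      (\<exists>P'. represents m' P' \<and> reachable s P' (g' rT) \<and>
        (g rT < g' rT \<or>
         g' rT = g rT \<and> P' = P \<and> (\<forall>l. j \<le> l \<and> l < n \<longrightarrow> \<not> accepts s P (g rT) l)))"
  let ?g = "g(rJ := if rN = rJ then 0 else g rN)"
  have "wp (For rJ column)
     (\<lambda>t g' m'. t \<le> ?g rJ * ((30 * n + 40) + 2) + 1 \<and> ?I 0 g' m' \<and> g' rJ = 0 \<and> g' rOne = 1) ?g m"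
  proof (rule wp_For, goal_cases)
    case 1
    show ?case using m reach g by (auto simp: env_def)
  next
    case (4 j h mm)
    then obtain P' where P': "represents mm P'" "reachable s P' (h rT)"
      "g rT < h rT \<or>
         h rT = g rT \<and> P' = P \<and> (\<forall>l. Suc j \<le> l \<and> l < n \<longrightarrow> \<not> accepts s P (g rT) l)"
      by blast
    have j: "j < n" using 4(1) g by (simp add: env_def)
    have h: "env h" "h rS = s" using 4 g s by (auto simp: env_def)
    show ?case
    proof (rule wp_mono[OF wp_column[OF P'(1) h(1) 4(3) j h(2) s(3)]], goal_cases)
      case (1 t h' mm')
      show ?case
      proof (cases "accepts s P' (h rT) j")
        case True
        then have "reachable s (\<lambda>i. P' i + s * a j i) (h' rT)"
          using 1 reachable_update[OF P'(2) s(2) j True] by simp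
        then show ?thesis using 1 True 4 P'(3) by auto
      next
        case False
        have "j \<le> l \<longleftrightarrow> l = j \<or> Suc j \<le> l" for l by auto
        with False have "\<forall>l. j \<le> l \<and> l < n \<longrightarrow> \<not> accepts s P (g rT) l" if "h rT = g rT" "P' = P"
          "\<forall>l. Suc j \<le> l \<and> l < n \<longrightarrow> \<not> accepts s P (g rT) l"
          using that by auto
        then show ?thesis using 1 False 4 P' by auto
      qed
    qed
  qed (use g in \<open>auto simp: env_def\<close>)
  then show ?thesis
    unfolding pass_def block.simps wp_Seq wp_Copy
  proof (rule wp_mono, goal_cases)
    case (1 t g' m')
    then obtain P' where P': "represents m' P'" "reachable s P' (g' rT)"
      and prog: "g rT < g' rT \<or> (\<forall>l<n. \<not> accepts s P (g rT) l)"
      by auto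
    have "g rT < g' rT" if "s \<le> \<tau>"
      using prog some_column_accepted[OF s(2) that] by blast
    moreover have "t \<le> n * (30 * n + 42) + 1" using 1 g by (simp add: env_def algebra_simps)
    ultimately show ?case using 1 P' by auto
  qed
qed

lemma wp_reset:
  assumes m: "matrix m" and g: "env g"
  shows "wp reset (\<lambda>t g' m'. t \<le> 7 * n + 6 \<and>
      (\<forall>r. r \<notin> {rI, rAddr, rVal, rIdx} \<longrightarrow> g' r = g r) \<and> represents m' (\<lambda>_. 0)) g m"
proof -
  let ?I = "\<lambda>i g' m'. matrix m' \<and> (\<forall>l. i \<le> l \<and> l < n \<longrightarrow> m' (n * n + l) = 0) \<and>
      (\<forall>r. r \<notin> {rI, rAddr, rVal, rIdx} \<longrightarrow> g' r = g r) \<and> g' rVal = 0"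
  let ?g = "g(rI := n, rVal := 0)"
  have "wp (For rI (block [Sub rIdx rI rOne, Add rAddr rNN rIdx, Store rAddr rVal]))
     (\<lambda>t g' m'. t \<le> ?g rI * (5 + 2) + 1 \<and> ?I 0 g' m' \<and> g' rI = 0 \<and> g' rOne = 1) ?g m"
  proof (rule wp_For[where I = ?I], goal_cases)
    case (4 i h mm)
    moreover have "i \<le> l \<longleftrightarrow> l = i \<or> Suc i \<le> l" for l by auto
    ultimately show ?case using g by (auto simp: env_def matrix_store)
  qed (use m g in \<open>auto simp: env_def\<close>)
  then show ?thesis
    using g by (auto simp: reset_def env_def represents_def elim!: wp_mono)
qed

text \<open>
  After $n^5$ passes, $s \le \tau$ implies $t \ge n^5$ since every pass makes progress, and
  $t \ge n^5$ implies $s \le \tau$ by \<open>many_updates_imp_le_value\<close>.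
\<close>

lemma wp_test:
  assumes m: "matrix m" and g: "env g" "g rQ = n ^ 5" and s: "g rS = s" "1 \<le> s" "s \<le> n"
  shows "wp test (\<lambda>t g' m'. t \<le> test_time n \<and>
      (\<forall>r. r \<notin> {rOut, rT, rPass, rJ, rI, rA, rB, rBase, rAddr, rVal, rIdx, rCnt, rProd}
         \<longrightarrow> g' r = g r) \<and>
      g' rOut = g rOut + (if s \<le> \<tau> then g rK else 0) \<and> matrix m') g m"
proof -
  have main: "wp (For rPass pass)
     (\<lambda>t g' m'. t \<le> h rPass * ((n * (30 * n + 42) + 4) + 2) + 1 \<and>
        ((\<forall>r. r \<notin> {rPass, rT, rJ, rI, rA, rB, rBase, rAddr, rVal, rIdx, rCnt, rProd} \<longrightarrow> g' r = h r) \<and>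
         (\<exists>P'. represents m' P' \<and> reachable s P' (g' rT)) \<and>
         (s \<le> \<tau> \<longrightarrow> n ^ 5 \<le> g' rT + 0)) \<and> g' rPass = 0 \<and> g' rOne = 1) h mm"
    if "represents mm (\<lambda>_. 0)" "env h" "h rPass = n ^ 5" "h rT = 0" "h rS = s" for h mm
  proof (rule wp_For[where I = "\<lambda>p g' m'.
      (\<forall>r. r \<notin> {rPass, rT, rJ, rI, rA, rB, rBase, rAddr, rVal, rIdx, rCnt, rProd} \<longrightarrow> g' r = h r) \<and>
      (\<exists>P'. represents m' P' \<and> reachable s P' (g' rT)) \<and>
      (s \<le> \<tau> \<longrightarrow> n ^ 5 \<le> g' rT + p)"], goal_cases)
    case 1
    show ?case using that reachable_initial[of "\<lambda>_. 0" s] by auto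
  next
    case (4 p h' mm')
    then obtain P' where P': "represents mm' P'" "reachable s P' (h' rT)" by blast
    have h': "env h'" "h' rS = s" using 4 that by (auto simp: env_def)
    show ?case
      by (rule wp_mono[OF wp_pass[OF P'(1) h' s(2,3) P'(2)]]) (use 4 h'(1) in \<open>auto simp: env_def\<close>)
  qed (use that in \<open>auto simp: env_def\<close>)
  show ?thesis
    unfolding test_def block.simps wp_Seq
  proof (rule wp_mono[OF wp_reset[OF m g(1)]], goal_cases)
    case (1 t1 g1 m1)
    show ?case
      unfolding wp_basic(2) wp_Copy
    proof (rule wp_mono[OF main], goal_cases)
      case (6 t2 g2 m2)
      then obtain P' where P': "represents m2 P'" "reachable s P' (g2 rT)" by blast
      have iff: "n ^ 5 \<le> g2 rT \<longleftrightarrow> s \<le> \<tau>"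
        using 6 many_updates_imp_le_value[OF P'(2) s(2,3)] by auto
      have "g2 rQ = n ^ 5" "g2 rK = g rK" "g2 rOut = g rOut" using 6 1 g by auto
      moreover have "t2 \<le> n ^ 5 * (n * (30 * n + 42) + 4 + 2) + 1" using 6 1 g by simp
      then have "t1 + t2 + 13 \<le> test_time n"
        using 1 by (simp add: test_time_def add.commute[of 6])
      ultimately show ?case using 6 1 iff P'(1) g by (auto simp: represents_def)
    qed (use 1 g s in \<open>auto simp: env_def\<close>)
  qed
qed

lemma wp_set_diagonal:
  assumes m: "\<And>i j. i < n \<Longrightarrow> j < n \<Longrightarrow> i \<noteq> j \<Longrightarrow> m (i * n + j) = a i j"
    and diag: "\<And>i. i < n \<Longrightarrow> a i i = 1" and g: "env g"
  shows "wp set_diagonal (\<lambda>t g' m'. t \<le> n * (3 * n + 11) + 4 \<and>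
      (\<forall>r. r \<notin> {rI, rAddr, rIdx, rCnt} \<longrightarrow> g' r = g r) \<and> matrix m') g m"
proof -
  let ?I = "\<lambda>i g' m'. (\<forall>l<n. \<forall>j<n. i \<le> l \<or> l \<noteq> j \<longrightarrow> m' (l * n + j) = a l j) \<and>
      (\<forall>r. r \<notin> {rI, rAddr, rIdx, rCnt} \<longrightarrow> g' r = g r)"
  let ?g = "g(rI := n)"
  have "wp (For rI (block [Sub rIdx rI rOne, Mul rAddr rIdx rN, Add rAddr rAddr rIdx, Store rAddr rOne]))
     (\<lambda>t g' m'. t \<le> ?g rI * ((3 * n + 9) + 2) + 1 \<and> ?I 0 g' m' \<and> g' rI = 0 \<and> g' rOne = 1) ?g m"
  proof (rule wp_For, goal_cases)
    case (4 i h mm)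
    have i: "i < n" using 4(1) by simp
    have split: "i \<le> l \<longleftrightarrow> l = i \<or> Suc i \<le> l" for l by auto
    have upd: "\<forall>l<n. \<forall>j<n. i \<le> l \<or> l \<noteq> j \<longrightarrow> (mm(i * n + i := 1)) (l * n + j) = a l j"
      using 4(2) i diag split by (auto simp: cell_inj)
    show ?case
      unfolding block.simps wp_Seq wp_basic(4)
    proof (rule wp_mono[OF wp_Mul], goal_cases)
      case (8 t1 g1 m1)
      then show ?case using 4 upd g i by (auto simp: env_def)
    qed (use 4 in auto)
  qed (use m g in \<open>auto simp: env_def\<close>)
  then show ?thesis
    using g by (auto simp: set_diagonal_def env_def matrix_def algebra_simps elim!: wp_mono)
qed

text \<open>
  When the guesses above \<open>s\<close> have been tested, the output is $k$ times the number of those that are at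
  most \<open>\<tau>\<close>, which is \<open>k * (\<tau> - s)\<close> with truncated subtraction; here \<open>\<tau> \<le> n\<close> is used.
\<close>

lemma wp_main:
  assumes m: "\<And>i j. i < n \<Longrightarrow> j < n \<Longrightarrow> i \<noteq> j \<Longrightarrow> m (i * n + j) = a i j"
    and diag: "\<And>i. i < n \<Longrightarrow> a i i = 1" and g: "g rN = n"
  shows "wp (main k) (\<lambda>t g' m'. t \<le> main_time n \<and> g' rN = k * \<tau>) g m"
proof -
  have loop: "wp (For rS test)
      (\<lambda>t g' m'. t \<le> h rS * (test_time n + 2) + 1 \<and>
        (env g' \<and> g' rQ = n ^ 5 \<and> g' rK = k \<and> matrix m' \<and> g' rOut = k * (\<tau> - 0))
        \<and> g' rS = 0 \<and> g' rOne = 1) h mm"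
    if "env h" "h rQ = n ^ 5" "h rK = k" "matrix mm" "h rOut = 0" "h rS = n" for h mm
  proof (rule wp_For[where I = "\<lambda>s g' m'. env g' \<and> g' rQ = n ^ 5 \<and> g' rK = k \<and> matrix m' \<and>
      g' rOut = k * (\<tau> - s)"], goal_cases)
    case 1
    show ?case using that value_le by simp
  next
    case (4 s h' mm')
    have *: "matrix mm'" "env h'" "h' rQ = n ^ 5" "h' rS = Suc s" "1 \<le> Suc s" "Suc s \<le> n"
      using 4 that by auto
    have out: "k * (\<tau> - Suc s) + (if Suc s \<le> \<tau> then k else 0) = k * (\<tau> - s)"
    proof (cases "Suc s \<le> \<tau>")
      case True
      then have "\<tau> - s = Suc (\<tau> - Suc s)" by simp
      then show ?thesis using True by simp
    qed simp
    show ?case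
      by (rule wp_mono[OF wp_test[OF *]]) (use 4 out in \<open>auto simp: env_def\<close>)
  qed (use that in \<open>auto simp: env_def\<close>)
  show ?thesis
    unfolding main_def block.simps wp_Seq wp_basic(2)
  proof (rule wp_mono[OF wp_Mul], goal_cases)
    case (8 t1 g1 m1)
    then have g1: "env g1" "g1 rK = k" "m1 = m" "t1 \<le> 3 * n + 5" using g by (auto simp: env_def)
    show ?case
    proof (rule wp_mono[OF wp_Mul], goal_cases)
      case (8 t2 g2 m2)
      then have g2: "env g2" "g2 rK = k" "m2 = m" "t2 \<le> 3 * n\<^sup>2 + 5" "g2 rProd = n ^ 4"
        using g1 by (auto simp: env_def eval_nat_numeral)
      show ?case
      proof (rule wp_mono[OF wp_Mul], goal_cases)
        case (8 t3 g3 m3)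
        then have g3: "env g3" "g3 rK = k" "m3 = m" "t3 \<le> 3 * n + 5" "g3 rQ = n ^ 5"
          using g2 by (auto simp: env_def eval_nat_numeral)
        show ?case
        proof (rule wp_mono[OF wp_set_diagonal], goal_cases)
          case (4 t4 g4 m4)
          then have g4: "env g4" "g4 rK = k" "g4 rQ = n ^ 5" using g3 by (auto simp: env_def)
          show ?case
            unfolding wp_Copy
          proof (rule wp_mono[OF loop], goal_cases)
            case (7 t5 g5 m5)
            have "t4 \<le> n * (3 * n + 11) + 4" using 4 by blast
            moreover have "t5 \<le> n * (test_time n + 2) + 1" using 7 g4 by (simp add: env_def)
            ultimately have "t1 + t2 + t3 + t4 + t5 + 20 \<le> main_time n"
              using g1(4) g2(4) g3(4) unfolding main_time_def by linarith
            then show ?case using 7 by simp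
          qed (use g4 4 in \<open>auto simp: env_def\<close>)
        qed (use m diag g3 in auto)
      qed (use g2 in \<open>auto simp: env_def\<close>)
    qed (use g1 in \<open>auto simp: env_def\<close>)
  qed auto
qed

end

section \<open>Computing the packing number in polynomial time\<close>

text \<open>
  Perfection enters through \<open>packing_bound\<close> alone. A cheap column is found by averaging over
  an optimal 1-limited packing, for which the closed neighbourhoods of its vertices are disjoint.
\<close>

lemma perfect_covering_game:
  assumes G: "pair_graph G" and perf: "perfect_matrix (pverts G) (pverts G) (closed_nbhd_matrix G)"
    and vs: "distinct vs" "set vs = pverts G"
  shows "covering_game (\<lambda>i j. of_bool (i = j \<or> (vs ! i, vs ! j) \<in> parcs G)) (length vs) (L_lim 1 G)"
    (is "covering_game ?a ?n ?\<tau>")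
proof -
  interpret pair_graph G by fact
  have bij: "bij_betw ((!) vs) {..<?n} (pverts G)"
    using bij_betw_nth[OF vs(1), of "{..<?n}"] vs(2) by simp
  have total: "(\<Sum>v\<in>pverts G. f v) = (\<Sum>j<?n. f (vs ! j))" for f :: "'a \<Rightarrow> nat"
    by (rule sum.reindex_bij_betw[OF bij, symmetric])
  have nbhd: "(\<Sum>w\<in>closed_nbhd G (vs ! i). f w) = (\<Sum>j<?n. ?a i j * f (vs ! j))"
    if "i < ?n" for i and f :: "'a \<Rightarrow> nat"
  proof -
    have "vs ! i \<in> pverts G" using that vs(2) by (metis nth_mem)
    then have "(\<Sum>w\<in>closed_nbhd G (vs ! i). f w)
        = (\<Sum>j<?n. of_bool (vs ! i = vs ! j \<or> (vs ! i, vs ! j) \<in> parcs G) * f (vs ! j))"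
      by (simp only: sum_closed_nbhd[OF G] total)
    also have "\<dots> = (\<Sum>j<?n. ?a i j * f (vs ! j))"
      using that vs(1) by (intro sum.cong) (auto simp: nth_eq_iff_index_eq)
    finally show ?thesis .
  qed
  obtain f where f: "limited_packing 1 G f" "(\<Sum>v\<in>pverts G. f v) = ?\<tau>"
    using L_lim_attained[OF G] by metis
  have f01: "f (vs ! j) \<le> 1" if "j < ?n" for j
    using f(1) that vs(2) nth_mem[OF that] unfolding limited_packing_def by fastforce
  show ?thesis
  proof
    show "?a i j \<le> 1" for i j by simp
    show "?a i j = ?a j i" for i j using arcs_symmetric by (auto simp: of_bool_def)
    show "(\<Sum>j<?n. c j) \<le> M * ?\<tau>" if c: "\<And>i. i < ?n \<Longrightarrow> (\<Sum>j<?n. ?a i j * c j) \<le> M" for c M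
    proof -
      define h where "h v = c (the_inv_into {..<?n} ((!) vs) v)" for v
      have h: "h (vs ! j) = c j" if "j < ?n" for j
        using that bij by (simp add: h_def bij_betw_def the_inv_into_f_f)
      have "(\<Sum>w\<in>closed_nbhd G v. h w) \<le> M" if "v \<in> pverts G" for v
      proof -
        obtain i where i: "i < ?n" "v = vs ! i" using \<open>v \<in> pverts G\<close> vs(2) by (metis in_set_conv_nth)
        then show ?thesis using c[OF i(1)] by (simp add: nbhd h)
      qed
      then have "brace_packing_function M G h" by (simp add: brace_packing_function_def)
      then show ?thesis using perfect_brace_packing_bound[OF G perf, of M h] by (simp add: total h)
    qed
    show "\<exists>j<?n. ?\<tau> * (\<Sum>i<?n. ?a j i * d i) \<le> (\<Sum>i<?n. d i)" if "1 \<le> ?\<tau>" for d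
    proof (rule ccontr)
      let ?X = "\<lambda>j. \<Sum>i<?n. ?a j i * d i"
      let ?D = "\<Sum>i<?n. d i"
      assume "\<not> ?thesis"
      then have big: "Suc ?D \<le> ?\<tau> * ?X j" if "j < ?n" for j using that by (meson not_less_eq_eq)
      \<comment> \<open>Otherwise each column of the packing costs more than \<open>?D / ?\<tau>\<close>, and all of them together more than \<open>?D\<close>.\<close>
      have "?\<tau> * Suc ?D = (\<Sum>j<?n. f (vs ! j) * Suc ?D)"
        unfolding sum_distrib_right[symmetric] using f(2) total by simp
      also have "\<dots> \<le> (\<Sum>j<?n. f (vs ! j) * (?\<tau> * ?X j))"
        using big by (intro sum_mono mult_left_mono) auto
      also have "\<dots> = ?\<tau> * (\<Sum>j<?n. \<Sum>i<?n. f (vs ! j) * (?a j i * d i))"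
        by (simp only: sum_distrib_left mult.left_commute)
      also have "(\<Sum>j<?n. \<Sum>i<?n. f (vs ! j) * (?a j i * d i)) = (\<Sum>i<?n. \<Sum>j<?n. f (vs ! j) * (?a j i * d i))"
        by (rule sum.swap)
      also have "\<dots> = (\<Sum>i<?n. (\<Sum>j<?n. ?a i j * f (vs ! j)) * d i)"
        unfolding sum_distrib_right
        using arcs_symmetric by (intro sum.cong refl) (auto simp: of_bool_def)
      also have "\<dots> \<le> (\<Sum>i<?n. 1 * d i)"
      proof (intro sum_mono mult_right_mono)
        fix i assume "i \<in> {..<?n}"
        then have i: "i < ?n" by simp
        then have "vs ! i \<in> pverts G" using vs(2) by (metis nth_mem)
        then show "(\<Sum>j<?n. ?a i j * f (vs ! j)) \<le> 1"
          unfolding nbhd[OF i, symmetric] using f(1) by (simp add: limited_packing_def)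
      qed simp
      finally have "?\<tau> * Suc ?D \<le> ?\<tau> * ?D" by simp
      then show False using that by simp
    qed
    have "?\<tau> = (\<Sum>j<?n. f (vs ! j))" using f(2) total by simp
    also have "\<dots> \<le> (\<Sum>j<?n. 1)" using f01 by (intro sum_mono) auto
    finally show "?\<tau> \<le> ?n" by simp
  qed
qed

lemma main_time_poly: "\<exists>p :: nat poly. \<forall>n. poly p n = main_time n"
proof (intro exI allI)
  let ?x = "[:0, 1:] :: nat poly"
  let ?c = "\<lambda>c :: nat. [:c:]"
  show "poly (?c 3 * ?x\<^sup>2 + ?x * (?c 3 * ?x + ?c 11)
     + ?x * ((?x ^ 5 * (?x * (?c 30 * ?x + ?c 42) + ?c 6) + ?c 7 * ?x + ?c 20) + ?c 2) + ?c 6 * ?x + ?c 40) n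
    = main_time n" for n
    unfolding main_time_def test_time_def by (simp only: poly_add poly_mult poly_power poly_pCons poly_0 mult_0_right add_0_right add_0 mult_1_right)
qed

theorem theorem2p1:
  fixes k :: nat
  assumes "k \<ge> 1"
  shows "(\<forall>G :: 'a pair_pre_digraph.
            pair_graph G \<and> Digraph_Component.connected (with_proj G) \<and>
            perfect_matrix (pverts G) (pverts G) (closed_nbhd_matrix G) \<longrightarrow>
            L_brace k G = k * L_lim 1 G) \<and>
         poly_time_computable_on
           {G :: nat pair_pre_digraph.
              pair_graph G \<and> perfect_matrix (pverts G) (pverts G) (closed_nbhd_matrix G)}
           (L_brace k)"
proof (intro conjI allI impI)
  fix G :: "'a pair_pre_digraph"
  assume "pair_graph G \<and> Digraph_Component.connected (with_proj G) \<and>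
            perfect_matrix (pverts G) (pverts G) (closed_nbhd_matrix G)"
  then show "L_brace k G = k * L_lim 1 G" using perfect_L_brace by blast
next
  obtain p :: "nat poly" where p: "\<And>n. poly p n = main_time n" using main_time_poly by blast
  show "poly_time_computable_on
           {G :: nat pair_pre_digraph.
              pair_graph G \<and> perfect_matrix (pverts G) (pverts G) (closed_nbhd_matrix G)}
           (L_brace k)"
    unfolding poly_time_computable_on_def
  proof (rule exI[of _ "main k"], rule exI[of _ p], intro ballI allI impI)
    fix G :: "nat pair_pre_digraph" and vs
    assume "G \<in> {G. pair_graph G \<and> perfect_matrix (pverts G) (pverts G) (closed_nbhd_matrix G)}"
    then have G: "pair_graph G" and perf: "perfect_matrix (pverts G) (pverts G) (closed_nbhd_matrix G)"
      by auto
    assume vs: "distinct vs \<and> set vs = pverts G"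
    let ?n = "length vs"
    interpret covering_game "\<lambda>i j. of_bool (i = j \<or> (vs ! i, vs ! j) \<in> parcs G)" ?n "L_lim 1 G"
      using perfect_covering_game[OF G perf] vs by blast
    obtain g m where gm: "graph_input G vs = (g, m)" by fastforce
    have "wp (main k) (\<lambda>t g' m'. t \<le> main_time ?n \<and> g' rN = k * L_lim 1 G) g m"
    proof (rule wp_main)
      show "g 0 = ?n" using gm by (auto simp: graph_input_def Let_def)
      show "m (i * ?n + j) = of_bool (i = j \<or> (vs ! i, vs ! j) \<in> parcs G)"
        if "i < ?n" "j < ?n" "i \<noteq> j" for i j
        using gm that cell_less[OF that(1,2)] cell_div[OF that(2), of i]
        by (auto simp: graph_input_def Let_def)
    qed simp
    then obtain t g' m' where "exec (main k) (g, m) t (g', m')" "t \<le> main_time ?n" "g' 0 = k * L_lim 1 G"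
      unfolding wp_def by blast
    then show "\<exists>t g' m'. exec (main k) (graph_input G vs) t (g', m') \<and> g' 0 = L_brace k G \<and> t \<le> poly p ?n"
      using gm p perfect_L_brace[OF G perf] by auto
  qed
qed

end
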